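(* Let $\lambda$ be a free nonzero complex parameter with $\lambda\notin\{-q^k:k\in\mathbb{Z}\}$. For all nonnegative integers $n,m$ the Stieltjes–Wigert polynomials satisfy the discrete orthogonality relation $$\sum_{k=-\infty}^\infty\frac{S_n(q^k\lambda;q)\,S_m(q^k\lambda;q)\,q^k\lambda}{\theta_q(q^k\lambda)}=\frac{\lambda}{1-q}\int_0^\infty\frac{S_n(x\lambda;q)\,S_m(x\lambda;q)}{\theta_q(x\lambda)}\,d_qx=\frac{\delta_{n,m}}{q^n\,(q;q)_n}.$$
   Context: Throughout $0<q<1$; $(a;q)_\infty=\prod_{j\ge0}(1-aq^j)$, $(a;q)_n=\prod_{j=0}^{n-1}(1-aq^j)$, and $\theta_q(\tau)=(q;q)_\infty(-\tau;q)_\infty(-q/\tau;q)_\infty=\sum_{k=-\infty}^\infty q^{\binom k2}\tau^k$. The Stieltjes–Wigert polynomials are $$S_n(x;q)=\frac1{(q;q)_n}\;{}_1\phi_1\!\left({q^{-n}\atop0};q;-xq^{n+1}\right)=\frac1{(q;q)_n}\sum_{j=0}^n\frac{(q^{-n};q)_j}{(q;q)_j}(-1)^jq^{\binom j2}(-xq^{n+1})^j.$$ The $q$-integral is $\int_0^\infty f(x)\,d_qx=(1-q)\sum_{k=-\infty}^\infty q^kf(q^k)$, and $\delta_{n,m}$ is the Kronecker delta. *)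

theory Defs
  imports "HOL-Analysis.Analysis"
begin

definition qpoch :: "complex \<Rightarrow> real \<Rightarrow> nat \<Rightarrow> complex" where
  "qpoch a q n = (\<Prod>j<n. 1 - a * of_real q ^ j)"

definition qpoch_inf :: "complex \<Rightarrow> real \<Rightarrow> complex" where
  "qpoch_inf a q = (\<Prod>j. 1 - a * of_real q ^ j)"

text \<open>The theta function is given by its product form; the bilateral series
  $\sum_k q^{\binom k2}\tau^k$ is then the Jacobi triple product identity.\<close>

definition qtheta :: "real \<Rightarrow> complex \<Rightarrow> complex" where
  "qtheta q \<tau> = qpoch_inf (of_real q) q * qpoch_inf (- \<tau>) q * qpoch_inf (- of_real q / \<tau>) q"

definition phi11 :: "complex \<Rightarrow> complex \<Rightarrow> real \<Rightarrow> complex \<Rightarrow> complex" where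
  "phi11 a b q z =
     (\<Sum>j. qpoch a q j / (qpoch b q j * qpoch (of_real q) q j)
            * (-1) ^ j * of_real q ^ (j choose 2) * z ^ j)"

definition stieltjes_wigert :: "nat \<Rightarrow> complex \<Rightarrow> real \<Rightarrow> complex" where
  "stieltjes_wigert n x q =
     1 / qpoch (of_real q) q n
       * phi11 (of_real q powi (- int n)) 0 q (- x * of_real q ^ (n + 1))"

definition q_integrable :: "real \<Rightarrow> (real \<Rightarrow> complex) \<Rightarrow> bool" where
  "q_integrable q f \<longleftrightarrow>
     (\<lambda>k::int. of_real (q powi k) * f (q powi k)) summable_on UNIV"

definition q_integral :: "real \<Rightarrow> (real \<Rightarrow> complex) \<Rightarrow> complex" where
  "q_integral q f =
     of_real (1 - q) * (\<Sum>\<^sub>\<infinity>k::int. of_real (q powi k) * f (q powi k))"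

lemma qpoch_neg_power_eq_0:
  assumes "q \<noteq> 0" and "n < j"
  shows "qpoch (of_real q powi (- int n)) q j = 0"
  using assms by (auto simp: qpoch_def power_int_minus intro!: bexI[of _ n])

text \<open>For these parameters the series terminates, giving the explicit polynomial.\<close>

lemma stieltjes_wigert_eq_sum:
  assumes "q \<noteq> 0"
  shows "stieltjes_wigert n x q =
     1 / qpoch (of_real q) q n *
       (\<Sum>j=0..n. qpoch (of_real q powi (- int n)) q j / qpoch (of_real q) q j
            * (-1) ^ j * of_real q ^ (j choose 2) * (- x * of_real q ^ (n + 1)) ^ j)"
proof -
  have "qpoch 0 q j = 1" for j
    by (simp add: qpoch_def)
  moreover have "phi11 (of_real q powi (- int n)) 0 q z =
      (\<Sum>j=0..n. qpoch (of_real q powi (- int n)) q j / (qpoch 0 q j * qpoch (of_real q) q j)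
            * (-1) ^ j * of_real q ^ (j choose 2) * z ^ j)" for z
    unfolding phi11_def
    by (rule suminf_finite) (auto simp: qpoch_neg_power_eq_0[OF assms])
  ultimately show ?thesis
    by (simp add: stieltjes_wigert_def)
qed

end

theory Submission
  imports Defs
begin

text \<open>
  Put \<open>x\<^sub>k = q\<^sup>k \<lambda>\<close>. Everything rests on the moments of the discrete measure with weight
  \<open>x\<^sub>k / \<theta>(x\<^sub>k)\<close> at \<open>x\<^sub>k\<close>. Since \<open>\<theta>(q\<tau>) = \<theta>(\<tau>) / \<tau>\<close>, the number
  \<open>1 / \<theta>(x\<^sub>k)\<close> is, up to the constant \<open>1 / \<theta>(\<lambda>)\<close>, the \<open>k\<close>-th term of the bilateral
  theta series at \<open>\<lambda>\<close> (\<open>qtheta_power_int_mult\<close>). Multiplying by \<open>x\<^sub>k ^ (p + 1)\<close> adds a constant factor \<open>\<lambda> ^ (p + 1)\<close> and changes the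
  argument of that series to \<open>q ^ (p + 1) \<lambda>\<close>, so Jacobi's triple product (\<open>jacobi_triple_product\<close>) sums it,
  and quasi-periodicity once more cancels \<open>\<theta>(\<lambda>)\<close>: the \<open>p\<close>-th moment is
  \<open>q ^ (- ((p + 1) choose 2))\<close>, whatever \<open>\<lambda>\<close> is (\<open>stieltjes_wigert_moment\<close>).

  With these moments the integral of \<open>S\<^sub>n(x) x ^ j\<close> becomes a \<open>q\<close>-binomial sum, equal to a multiple of
  \<open>(q ^ (- j); q)\<^sub>n\<close> (\<open>sum_sw_coeff_moment\<close>). This vanishes for \<open>j < n\<close>, which is the orthogonality, and
  its value at \<open>j = n\<close> times the leading coefficient of \<open>S\<^sub>n\<close> is the squared norm
  (\<open>sum_sw_coeff_moment_diag\<close>).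

  The triple product itself comes from the finite \<open>q\<close>-binomial theorem with \<open>2n\<close> factors centred at
  exponent \<open>0\<close>: the central \<open>q\<close>-binomials tend to \<open>1 / (q; q)\<^sub>\<infinity>\<close> and are bounded, so
  dominated convergence over the integers applies.
\<close>

section \<open>Finite products, coefficients and theta terms\<close>

lemma qpoch_0 [simp]: "qpoch a q 0 = 1"
  by (simp add: qpoch_def)

lemma qpoch_Suc: "qpoch a q (Suc n) = qpoch a q n * (1 - a * of_real q ^ n)"
  by (simp add: qpoch_def)

lemma qpoch_add: "qpoch a q (m + n) = qpoch a q m * qpoch (a * of_real q ^ m) q n"
  by (induction n) (simp_all add: qpoch_Suc power_add mult_ac)

definition qbinom :: "real \<Rightarrow> nat \<Rightarrow> nat \<Rightarrow> complex" where
  "qbinom q n k = qpoch (of_real q) q n / (qpoch (of_real q) q k * qpoch (of_real q) q (n - k))"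

text \<open>The \<open>k\<close>-th term of the bilateral theta series. The product \<open>k * (k - 1)\<close> is even for every
  integer \<open>k\<close>, so the division is exact also at negative indices.\<close>

definition theta_term :: "real \<Rightarrow> complex \<Rightarrow> int \<Rightarrow> complex" where
  "theta_term q \<tau> k = of_real q powi (k * (k - 1) div 2) * \<tau> powi k"

text \<open>The explicit coefficient of \<open>x ^ i\<close> in the Stieltjes--Wigert polynomial of degree \<open>n\<close>.
  The factor \<open>(q\<^sup>-\<^sup>n; q)\<^sub>i\<close> of the hypergeometric form has been reversed into
  \<open>(q; q)\<^sub>n / (q; q)\<^sub>n\<^sub>-\<^sub>i\<close>, which turns the coefficient into a \<open>q\<close>-binomial
  divided by \<open>(q; q)\<^sub>n\<close>, up to sign and power of \<open>q\<close>.\<close>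

definition sw_coeff :: "real \<Rightarrow> nat \<Rightarrow> nat \<Rightarrow> complex" where
  "sw_coeff q n i =
     (-1) ^ i * of_real q ^ (i ^ 2) / (qpoch (of_real q) q i * qpoch (of_real q) q (n - i))"

section \<open>Infinite sums\<close>

lemma has_sum_sum:
  fixes f :: "'a \<Rightarrow> 'b \<Rightarrow> 'c::{comm_monoid_add, topological_comm_monoid_add}"
  assumes "\<And>i. i \<in> I \<Longrightarrow> (f i has_sum s i) A"
  shows "((\<lambda>x. \<Sum>i\<in>I. f i x) has_sum (\<Sum>i\<in>I. s i)) A"
  using assms by (induction I rule: infinite_finite_induct) (auto intro: has_sum_add)

text \<open>This is the dominated convergence theorem for the counting measure, where unconditional
  summation over a set and Lebesgue integration agree on absolutely summable families.\<close>

lemma dominated_convergence_infsum: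
  fixes a :: "nat \<Rightarrow> 'a \<Rightarrow> complex"
  assumes lim: "\<And>k. (\<lambda>n. a n k) \<longlonglongrightarrow> b k"
    and bound: "\<And>n k. norm (a n k) \<le> M k"
    and M: "M summable_on UNIV"
  shows "(\<lambda>n. \<Sum>\<^sub>\<infinity>k. a n k) \<longlonglongrightarrow> (\<Sum>\<^sub>\<infinity>k. b k)"
proof -
  have M0: "0 \<le> M k" for k
    using bound[of 0 k] norm_ge_zero order_trans by blast
  have iM: "integrable (count_space UNIV) M"
    using M M0 by (simp add: abs_summable_equivalent[symmetric] flip: abs_summable_on_def)
  have b: "integrable (count_space UNIV) b"
    by (rule integrable_dominated_convergence[OF _ _ iM, of _ a]) (use lim bound in auto)
  have a: "integrable (count_space UNIV) (a n)" for n
    by (rule integrable_dominated_convergence2[OF _ _ iM, of b a]) (use lim bound in auto)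
  have "(\<lambda>n. integral\<^sup>L (count_space UNIV) (a n)) \<longlonglongrightarrow> integral\<^sup>L (count_space UNIV) b"
    by (rule integral_dominated_convergence[OF _ _ iM]) (use lim bound in auto)
  with a b show ?thesis
    by (simp add: infsetsum_infsum[symmetric] abs_summable_on_def infsetsum_def)
qed

section \<open>The finite \<open>q\<close>-binomial theorem\<close>

context
  fixes q :: real
  assumes q: "0 < q" "q < 1"
begin

lemma qpoch_q_nonzero: "qpoch (of_real q) q n \<noteq> 0"
proof -
  have "1 - complex_of_real q * complex_of_real q ^ j \<noteq> 0" for j
  proof -
    have "q ^ Suc j < 1"
      using q by (intro power_Suc_less_one) auto
    then show ?thesis
      by (metis eq_iff_diff_eq_0 less_irrefl of_real_1 of_real_eq_iff of_real_power power_Suc)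
  qed
  then show ?thesis
    by (simp add: qpoch_def)
qed

lemma qbinom_0 [simp]: "qbinom q n 0 = 1" and qbinom_self [simp]: "qbinom q n n = 1"
  by (simp_all add: qbinom_def qpoch_q_nonzero)

lemma qbinom_Suc_Suc:
  assumes "k < n"
  shows "qbinom q (Suc n) (Suc k) = qbinom q n (Suc k) + of_real q ^ (n - k) * qbinom q n k"
proof -
  obtain d where n: "n = Suc (k + d)"
    using assms less_iff_Suc_add by auto
  have nz: "1 - complex_of_real q ^ Suc j \<noteq> 0" for j
    using qpoch_q_nonzero[of "Suc j"] by (simp add: qpoch_Suc)
  have pascal: "N * (1 - x * y) / ((K * (1 - y)) * (D * (1 - x)))
      = N / ((K * (1 - y)) * D) + x * (N / (K * (D * (1 - x))))"
    if "K \<noteq> 0" "D \<noteq> 0" "1 - x \<noteq> 0" "1 - y \<noteq> 0" for N K D x y :: complex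
    using that by (simp add: divide_simps) (simp add: algebra_simps)
  show ?thesis
    using pascal[OF qpoch_q_nonzero[of k] qpoch_q_nonzero[of d] nz[of d] nz[of k],
        of "qpoch (of_real q) q n"]
    unfolding n qbinom_def by (simp add: qpoch_Suc power_add mult_ac)
qed

theorem q_binomial:
  "qpoch (- z) q n = (\<Sum>k\<le>n. qbinom q n k * of_real q ^ (k choose 2) * z ^ k)"
proof (induction n)
  case (Suc n)
  let ?Q = "complex_of_real q"
  define t where "t = (\<lambda>n k. qbinom q n k * ?Q ^ (k choose 2) * z ^ k)"
  have step: "t (Suc n) (Suc k) = t n (Suc k) + z * ?Q ^ n * t n k" if "k < n" for k
  proof -
    have "?Q ^ n = ?Q ^ (n - k) * ?Q ^ k"
      using that by (simp flip: power_add)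
    moreover have "Suc k choose 2 = k + (k choose 2)"
      by (simp add: numeral_2_eq_2)
    ultimately show ?thesis
      unfolding t_def qbinom_Suc_Suc[OF that] by (simp add: power_add algebra_simps)
  qed
  have last: "t (Suc n) (Suc n) = z * ?Q ^ n * t n n"
    by (simp add: t_def numeral_2_eq_2 power_add)
  have "(\<Sum>k\<le>Suc n. t (Suc n) k) = t (Suc n) 0 + (\<Sum>k<n. t (Suc n) (Suc k)) + t (Suc n) (Suc n)"
    by (simp add: sum.atMost_shift)
  also have "\<dots> = (t n 0 + (\<Sum>k<n. t n (Suc k))) + z * ?Q ^ n * ((\<Sum>k<n. t n k) + t n n)"
    by (simp add: step last sum.distrib sum_distrib_left algebra_simps) (simp add: t_def)
  also have "t n 0 + (\<Sum>k<n. t n (Suc k)) = (\<Sum>k\<le>n. t n k)"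
    by (metis lessThan_Suc_atMost sum.lessThan_Suc_shift)
  also have "(\<Sum>k<n. t n k) + t n n = (\<Sum>k\<le>n. t n k)"
    by (metis lessThan_Suc_atMost sum.lessThan_Suc)
  finally show ?case
    using Suc.IH by (simp add: t_def qpoch_Suc algebra_simps)
qed (simp add: binomial_eq_0)

section \<open>The terms of the theta series\<close>

lemma theta_term_0 [simp]: "theta_term q \<tau> 0 = 1"
  by (simp add: theta_term_def)

lemma theta_term_add_1:
  assumes "\<tau> \<noteq> 0"
  shows "theta_term q \<tau> (k + 1) = theta_term q \<tau> k * (of_real q powi k * \<tau>)"
proof -
  have "(k + 1) * (k + 1 - 1) div 2 = k * (k - 1) div 2 + k"
  proof -
    have "(k + 1) * (k + 1 - 1) = k * (k - 1) + k * 2"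
      by (simp add: algebra_simps)
    then show ?thesis by simp
  qed
  with assms q show ?thesis
    by (simp add: theta_term_def power_int_add power_int_add_1 mult_ac)
qed

lemma theta_term_nonzero: "\<tau> \<noteq> 0 \<Longrightarrow> theta_term q \<tau> k \<noteq> 0"
  using q by (simp add: theta_term_def)

lemma theta_term_nat: "theta_term q \<tau> (int n) = of_real q ^ (n choose 2) * \<tau> ^ n"
proof -
  have "int n * (int n - 1) div 2 = int (n choose 2)"
    by (cases n) (simp_all add: choose_two zdiv_int algebra_simps)
  then show ?thesis
    by (simp add: theta_term_def)
qed

text \<open>The inversion \<open>\<tau> \<mapsto> q / \<tau>\<close> exchanges the two halves of the bilateral series; estimates
  are therefore only needed at nonnegative indices.\<close>

lemma theta_term_uminus:
  "\<tau> \<noteq> 0 \<Longrightarrow> theta_term q \<tau> (- k) = theta_term q (of_real q / \<tau>) k"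
proof -
  have "(- k) * (- k - 1) div 2 = k * (k - 1) div 2 + k"
  proof -
    have "(- k) * (- k - 1) = k * (k - 1) + k * 2"
      by (simp add: algebra_simps)
    then show ?thesis by simp
  qed
  then show "\<tau> \<noteq> 0 \<Longrightarrow> ?thesis"
    using q by (simp add: theta_term_def power_int_add power_int_minus power_int_divide_distrib field_simps)
qed

lemma theta_term_mult_power_int:
  "theta_term q (of_real q powi m * \<tau>) k = theta_term q \<tau> k * (of_real q powi k) powi m"
  by (simp add: theta_term_def power_int_mult_distrib mult.commute[of m] flip: power_int_mult)

lemma theta_term_abs_summable:
  assumes "\<tau> \<noteq> 0"
  shows "(\<lambda>k. norm (theta_term q \<tau> k)) summable_on UNIV"
proof -
  have nat: "(\<lambda>n. norm (theta_term q \<sigma> (int n))) summable_on UNIV" if "\<sigma> \<noteq> 0" for \<sigma>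
  proof -
    have "(\<lambda>n. q ^ n * norm \<sigma>) \<longlonglongrightarrow> 0 * norm \<sigma>"
      using q by (intro tendsto_intros LIMSEQ_realpow_zero) auto
    then have "eventually (\<lambda>n. q ^ n * norm \<sigma> < 1/2) sequentially"
      by (rule order_tendstoD) simp
    then obtain N where N: "\<And>n. n \<ge> N \<Longrightarrow> q ^ n * norm \<sigma> < 1/2"
      by (auto simp: eventually_sequentially)
    have "summable (\<lambda>n. norm (theta_term q \<sigma> (int n)))"
    proof (rule summable_ratio_test[of "1/2" N])
      fix n assume "N \<le> n"
      have "theta_term q \<sigma> (int (Suc n)) = theta_term q \<sigma> (int n) * (of_real q ^ n * \<sigma>)"
        using theta_term_add_1[OF that, of "int n"] by (simp add: add.commute)
      then have "norm (theta_term q \<sigma> (int (Suc n))) = (q ^ n * norm \<sigma>) * norm (theta_term q \<sigma> (int n))"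
        using q by (simp add: norm_mult norm_power)
      also have "\<dots> \<le> 1/2 * norm (theta_term q \<sigma> (int n))"
        using N[OF \<open>N \<le> n\<close>] by (intro mult_right_mono) auto
      finally show "norm (norm (theta_term q \<sigma> (int (Suc n)))) \<le> 1/2 * norm (norm (theta_term q \<sigma> (int n)))"
        by simp
    qed simp
    then show ?thesis
      by (simp add: summable_on_UNIV_nonneg_real_iff)
  qed
  have pos: "(\<lambda>k. norm (theta_term q \<tau> k)) summable_on range int"
    using nat[OF assms] by (subst summable_on_reindex) (auto simp: o_def)
  have neg: "(\<lambda>k. norm (theta_term q \<tau> k)) summable_on range (\<lambda>n. - int n)"
    using nat[of "of_real q / \<tau>"] assms q
    by (subst summable_on_reindex) (auto simp: o_def inj_on_def theta_term_uminus)
  have "range int \<union> range (\<lambda>n. - int n) = UNIV"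
  proof (rule UNIV_eq_I[symmetric])
    show "k \<in> range int \<union> range (\<lambda>n. - int n)" for k
      by (cases k rule: int_cases2) auto
  qed
  with summable_on_union[OF pos neg] show ?thesis
    by simp
qed

section \<open>Jacobi's triple product\<close>

lemma qpoch_inf_convergent: "convergent_prod (\<lambda>j. 1 - a * complex_of_real q ^ j)"
proof (intro abs_convergent_prod_imp_convergent_prod summable_imp_abs_convergent_prod)
  show "summable (\<lambda>j. norm (1 - a * complex_of_real q ^ j - 1))"
    using q by (simp add: norm_mult norm_power summable_mult)
qed

lemma qpoch_tendsto: "(\<lambda>n. qpoch a q n) \<longlonglongrightarrow> qpoch_inf a q"
  using convergent_prod_LIMSEQ[OF qpoch_inf_convergent, of a]
  unfolding qpoch_def qpoch_inf_def LIMSEQ_lessThan_iff_atMost .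

lemma qpoch_inf_nonzero:
  assumes "\<And>j. a * of_real q ^ j \<noteq> 1"
  shows "qpoch_inf a q \<noteq> 0"
  unfolding qpoch_inf_def using assms by (intro prodinf_nonzero qpoch_inf_convergent) auto

lemma qpoch_inf_q_nonzero: "qpoch_inf (of_real q) q \<noteq> 0"
proof (rule qpoch_inf_nonzero)
  show "complex_of_real q * of_real q ^ j \<noteq> 1" for j
    using qpoch_q_nonzero[of "Suc j"] by (auto simp: qpoch_Suc)
qed

text \<open>This is the \<open>q\<close>-binomial theorem for \<open>2n\<close> factors at the argument \<open>\<tau> / q ^ n\<close>.
  Its last \<open>n\<close> factors form \<open>(-\<tau>; q)\<^sub>n\<close>; taking \<open>\<tau> q ^ (- l)\<close> out of each of the first \<open>n\<close>
  turns them into \<open>(-q / \<tau>; q)\<^sub>n\<close>. The extracted monomial is \<open>1 / theta_term q \<tau> (- n)\<close>, which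
  also recentres the sum.\<close>

lemma finite_triple_product:
  assumes "\<tau> \<noteq> 0"
  shows "qpoch (- \<tau>) q n * qpoch (- of_real q / \<tau>) q n
           = (\<Sum>i\<le>2*n. qbinom q (2*n) i * theta_term q \<tau> (int i - int n))"
proof -
  let ?Q = "complex_of_real q"
  have Q: "?Q \<noteq> 0" using q by simp
  have shift: "theta_term q \<tau> (int i - int n)
      = theta_term q \<tau> (- int n) * (?Q ^ (i choose 2) * (\<tau> / ?Q ^ n) ^ i)" for i
  proof (induction i)
    case (Suc i)
    have "theta_term q \<tau> (int (Suc i) - int n) = theta_term q \<tau> (int i - int n) * (?Q powi (int i - int n) * \<tau>)"
      using theta_term_add_1[OF assms, of "int i - int n"] by (simp add: algebra_simps)
    then show ?case
      using Q by (simp add: Suc.IH power_int_diff numeral_2_eq_2 power_add)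
  qed (simp add: binomial_eq_0)
  have refl: "qpoch (- (\<tau> / ?Q ^ n)) q n * theta_term q \<tau> (- int n) = qpoch (- of_real q / \<tau>) q n" for n
  proof (induction n)
    case (Suc n)
    have "theta_term q \<tau> (- int n) = theta_term q \<tau> (- int (Suc n)) * (\<tau> / ?Q ^ Suc n)"
      using theta_term_add_1[OF assms, of "- int (Suc n)"]
      unfolding power_int_minus power_int_of_nat by (simp add: field_simps)
    then have "theta_term q \<tau> (- int (Suc n)) = theta_term q \<tau> (- int n) * (?Q ^ Suc n / \<tau>)"
      using Q assms by simp
    moreover have "qpoch (- (\<tau> / ?Q ^ Suc n)) q (Suc n) = (1 + \<tau> / ?Q ^ Suc n) * qpoch (- (\<tau> / ?Q ^ n)) q n"
      using qpoch_add[of "- (\<tau> / ?Q ^ Suc n)" q 1 n] Q by (simp add: qpoch_Suc)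
    ultimately have "qpoch (- (\<tau> / ?Q ^ Suc n)) q (Suc n) * theta_term q \<tau> (- int (Suc n))
       = (qpoch (- (\<tau> / ?Q ^ n)) q n * theta_term q \<tau> (- int n)) * ((1 + \<tau> / ?Q ^ Suc n) * (?Q ^ Suc n / \<tau>))"
      by (simp only: mult_ac)
    also have "(1 + \<tau> / ?Q ^ Suc n) * (?Q ^ Suc n / \<tau>) = 1 - (- of_real q / \<tau>) * ?Q ^ n"
      using Q assms by (simp add: field_simps)
    finally show ?case
      by (simp only: Suc.IH qpoch_Suc)
  qed simp
  have "(\<Sum>i\<le>2*n. qbinom q (2*n) i * theta_term q \<tau> (int i - int n))
      = theta_term q \<tau> (- int n) * qpoch (- (\<tau> / ?Q ^ n)) q (2 * n)"
    by (simp add: shift q_binomial sum_distrib_left mult_ac)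
  also have "qpoch (- (\<tau> / ?Q ^ n)) q (2 * n) = qpoch (- (\<tau> / ?Q ^ n)) q n * qpoch (- \<tau>) q n"
    using Q by (simp add: mult_2 qpoch_add)
  also have "theta_term q \<tau> (- int n) * \<dots> = qpoch (- of_real q / \<tau>) q n * qpoch (- \<tau>) q n"
    using refl[of n] by (simp add: mult_ac)
  finally show ?thesis
    by simp
qed

theorem jacobi_triple_product:
  assumes "\<tau> \<noteq> 0"
  shows "(theta_term q \<tau> has_sum qtheta q \<tau>) UNIV"
proof -
  define f where "f = (\<lambda>n. qpoch (complex_of_real q) q n)"
  define L where "L = qpoch_inf (complex_of_real q) q"
  have f_lim: "f \<longlonglongrightarrow> L"
    unfolding f_def L_def by (rule qpoch_tendsto)
  have L: "L \<noteq> 0"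
    unfolding L_def by (rule qpoch_inf_q_nonzero)
  \<comment> \<open>Both \<open>f\<close> and its inverse converge, hence are bounded, and so are all the \<open>q\<close>-binomials.\<close>
  obtain B where B: "B > 0" "\<And>n. norm (f n) \<le> B"
    using convergent_imp_Bseq[OF convergentI[OF f_lim]] by (auto simp: Bseq_def)
  obtain C where C: "C > 0" "\<And>n. norm (inverse (f n)) \<le> C"
    using convergent_imp_Bseq[OF convergentI[OF tendsto_inverse[OF f_lim L]]] by (auto simp: Bseq_def)
  have binom_le: "norm (qbinom q m i) \<le> B * (C * C)" for m i
  proof -
    have "qbinom q m i = f m * (inverse (f i) * inverse (f (m - i)))"
      by (simp add: qbinom_def f_def divide_inverse)
    then show ?thesis
      using B C by (auto simp: norm_mult intro!: mult_mono simp del: norm_inverse)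
  qed
  \<comment> \<open>The finite identity, indexed symmetrically and extended by zero to all integers.\<close>
  define a where "a = (\<lambda>n k. if k \<in> {- int n..int n} then qbinom q (2*n) (nat (k + int n)) * theta_term q \<tau> k else 0)"
  have a_sum: "(\<Sum>\<^sub>\<infinity>k. a n k) = qpoch (- \<tau>) q n * qpoch (- of_real q / \<tau>) q n" for n
  proof -
    have "(\<Sum>\<^sub>\<infinity>k. a n k) = (\<Sum>k\<in>{- int n..int n}. a n k)"
      by (subst infsum_cong_neutral[where T="{- int n..int n}" and g="a n"]) (auto simp: a_def)
    also have "\<dots> = (\<Sum>i\<le>2*n. qbinom q (2*n) i * theta_term q \<tau> (int i - int n))"
      by (rule sum.reindex_bij_witness[of _ "\<lambda>i. int i - int n" "\<lambda>k. nat (k + int n)"]) (auto simp: a_def)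
    finally show ?thesis
      using finite_triple_product[OF assms] by simp
  qed
  have a_lim: "(\<lambda>n. a n k) \<longlonglongrightarrow> theta_term q \<tau> k / L" for k
  proof -
    have lim: "filterlim (\<lambda>n. nat (k + int n)) at_top sequentially" for k
      unfolding filterlim_at_top
    proof
      show "\<forall>\<^sub>F n in sequentially. Z \<le> nat (k + int n)" for Z
        using eventually_ge_at_top[of "Z + nat \<bar>k\<bar>"] by eventually_elim auto
    qed
    have lim2: "filterlim (\<lambda>n::nat. 2 * n) at_top sequentially"
      by (rule filterlim_subseq) (simp add: strict_mono_def)
    have "(\<lambda>n. f (2*n) / (f (nat (k + int n)) * f (nat (- k + int n))) * theta_term q \<tau> k) \<longlonglongrightarrow> L / (L * L) * theta_term q \<tau> k"
      using L by (intro tendsto_intros filterlim_compose[OF f_lim lim] filterlim_compose[OF f_lim lim2]) auto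
    moreover have "\<forall>\<^sub>F n in sequentially. f (2*n) / (f (nat (k + int n)) * f (nat (- k + int n))) * theta_term q \<tau> k = a n k"
      using eventually_ge_at_top[of "nat \<bar>k\<bar>"]
    proof eventually_elim
      case (elim n)
      then have "2 * n - nat (k + int n) = nat (- k + int n)" "k \<in> {- int n..int n}"
        by auto
      then show ?case
        by (simp add: a_def qbinom_def f_def)
    qed
    ultimately have "(\<lambda>n. a n k) \<longlonglongrightarrow> L / (L * L) * theta_term q \<tau> k"
      by (rule Lim_transform_eventually)
    then show ?thesis
      using L by simp
  qed
  have "(\<lambda>n. \<Sum>\<^sub>\<infinity>k. a n k) \<longlonglongrightarrow> (\<Sum>\<^sub>\<infinity>k. theta_term q \<tau> k / L)"
  proof (rule dominated_convergence_infsum[OF a_lim])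
    show "norm (a n k) \<le> B * (C * C) * norm (theta_term q \<tau> k)" for n k
      using binom_le B C by (auto simp: a_def norm_mult intro!: mult_right_mono)
    show "(\<lambda>k. B * (C * C) * norm (theta_term q \<tau> k)) summable_on UNIV"
      by (intro summable_on_cmult_right theta_term_abs_summable assms)
  qed
  moreover have "(\<lambda>n. \<Sum>\<^sub>\<infinity>k. a n k) \<longlonglongrightarrow> qpoch_inf (- \<tau>) q * qpoch_inf (- of_real q / \<tau>) q"
    unfolding a_sum by (intro tendsto_intros qpoch_tendsto)
  ultimately have "(\<Sum>\<^sub>\<infinity>k. theta_term q \<tau> k / L) = qpoch_inf (- \<tau>) q * qpoch_inf (- of_real q / \<tau>) q"
    by (rule LIMSEQ_unique)
  then have "(\<Sum>\<^sub>\<infinity>k. theta_term q \<tau> k) * inverse L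
      = qpoch_inf (- \<tau>) q * qpoch_inf (- of_real q / \<tau>) q"
    unfolding divide_inverse infsum_cmult_left' .
  then have "(\<Sum>\<^sub>\<infinity>k. theta_term q \<tau> k) = L * (qpoch_inf (- \<tau>) q * qpoch_inf (- of_real q / \<tau>) q)"
    using L by (metis divide_inverse eq_divide_imp mult.commute nonzero_divide_eq_eq)
  then have "(\<Sum>\<^sub>\<infinity>k. theta_term q \<tau> k) = qtheta q \<tau>"
    unfolding L_def qtheta_def by (simp only: mult.assoc)
  then show ?thesis
    using abs_summable_summable[OF theta_term_abs_summable[OF assms]] by (simp add: has_sum_iff)
qed

text \<open>Quasi-periodicity: by the triple product, shifting the summation index by one in the theta
  series amounts to replacing \<open>\<tau>\<close> by \<open>q\<tau>\<close> and multiplying by \<open>\<tau>\<close>. Iterating the resulting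
  \<open>\<theta>(q\<tau>) = \<theta>(\<tau>) / \<tau>\<close> in both directions accumulates exactly a term of the series.\<close>

lemma qtheta_power_int_mult:
  assumes "\<tau> \<noteq> 0"
  shows "qtheta q (of_real q powi k * \<tau>) = qtheta q \<tau> / theta_term q \<tau> k"
proof -
  let ?Q = "complex_of_real q"
  have Q: "?Q \<noteq> 0" using q by simp
  have step: "qtheta q \<sigma> = \<sigma> * qtheta q (?Q * \<sigma>)" if "\<sigma> \<noteq> 0" for \<sigma>
  proof -
    have "((\<lambda>k. \<sigma> * theta_term q (?Q * \<sigma>) k) has_sum \<sigma> * qtheta q (?Q * \<sigma>)) UNIV"
      using that Q by (intro has_sum_cmult_right jacobi_triple_product) auto
    also have "(\<lambda>k. \<sigma> * theta_term q (?Q * \<sigma>) k) = (\<lambda>k. theta_term q \<sigma> (k + 1))"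
      using theta_term_mult_power_int[of 1 \<sigma>] that by (simp add: theta_term_add_1 mult_ac)
    also have "(\<dots> has_sum \<sigma> * qtheta q (?Q * \<sigma>)) UNIV \<longleftrightarrow> (theta_term q \<sigma> has_sum \<sigma> * qtheta q (?Q * \<sigma>)) UNIV"
      by (rule has_sum_reindex_bij_witness[of _ "\<lambda>k. k - 1" "\<lambda>k. k + 1"]) auto
    finally show ?thesis
      using jacobi_triple_product[OF that] has_sum_unique by blast
  qed
  have succ: "qtheta q (?Q powi (k + 1) * \<tau>) * theta_term q \<tau> (k + 1) = qtheta q (?Q powi k * \<tau>) * theta_term q \<tau> k" for k
    using step[of "?Q powi k * \<tau>"] assms Q
    by (simp add: theta_term_add_1 power_int_add_1 mult_ac)
  have "qtheta q (?Q powi k * \<tau>) * theta_term q \<tau> k = qtheta q \<tau>"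
  proof (induction k rule: int_induct[where k=0])
    case (step2 i)
    then show ?case using succ[of "i - 1"] by simp
  qed (use succ in simp_all)
  then show ?thesis
    using theta_term_nonzero[OF assms] by (simp add: field_simps)
qed

lemma qtheta_nonzero:
  assumes "\<tau> \<noteq> 0" and "\<tau> \<notin> {- of_real (q powi k) | k::int. True}"
  shows "qtheta q \<tau> \<noteq> 0"
proof -
  let ?Q = "complex_of_real q"
  have Q: "?Q \<noteq> 0" using q by simp
  have ne: "\<tau> \<noteq> - (?Q powi k)" for k
    using assms(2) by (auto simp flip: of_real_power_int)
  have "qpoch_inf (- \<tau>) q \<noteq> 0"
  proof (rule qpoch_inf_nonzero)
    show "- \<tau> * ?Q ^ j \<noteq> 1" for j
    proof
      assume "- \<tau> * ?Q ^ j = 1"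
      then have "- \<tau> = inverse (?Q ^ j)"
        by (metis inverse_unique mult.commute)
      then have "\<tau> = - (?Q powi (- int j))"
        by (metis minus_minus power_int_minus power_int_of_nat)
      with ne show False by blast
    qed
  qed
  moreover have "qpoch_inf (- ?Q / \<tau>) q \<noteq> 0"
  proof (rule qpoch_inf_nonzero)
    show "- ?Q / \<tau> * ?Q ^ j \<noteq> 1" for j
    proof
      assume "- ?Q / \<tau> * ?Q ^ j = 1"
      then have "- (?Q ^ Suc j) = \<tau>"
        using assms(1) by (simp add: field_simps)
      then have "\<tau> = - (?Q powi int (Suc j))"
        unfolding power_int_of_nat by simp
      with ne show False by blast
    qed
  qed
  ultimately show ?thesis
    using qpoch_inf_q_nonzero by (simp add: qtheta_def)
qed


section \<open>Moments\<close>

text \<open>The weights \<open>1 / \<theta>(q\<^sup>k \<tau>)\<close> are theta terms at \<open>\<tau>\<close>, and the powers of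
  \<open>q\<^sup>k\<close> are absorbed by moving the argument to \<open>q ^ (p + 1) \<tau>\<close>. The two values of \<open>\<theta>\<close> that
  remain have an explicit quotient, so the answer does not depend on \<open>\<tau>\<close>.\<close>

lemma stieltjes_wigert_moment:
  assumes "\<tau> \<noteq> 0" and "\<tau> \<notin> {- of_real (q powi k) | k::int. True}"
  shows "((\<lambda>k. (of_real (q powi k) * \<tau>) ^ Suc p / qtheta q (of_real (q powi k) * \<tau>))
           has_sum inverse (of_real q ^ (Suc p choose 2))) UNIV"
proof -
  let ?Q = "complex_of_real q"
  have Q: "?Q \<noteq> 0" using q by simp
  have \<theta>: "qtheta q \<tau> \<noteq> 0"
    using assms by (rule qtheta_nonzero)
  let ?\<sigma> = "?Q ^ Suc p * \<tau>"
  have terms: "theta_term q ?\<sigma> k = theta_term q \<tau> k * (?Q powi k) ^ Suc p" for k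
    using theta_term_mult_power_int[of "int (Suc p)" \<tau> k] unfolding power_int_of_nat .
  have shifted: "qtheta q ?\<sigma> = qtheta q \<tau> / (?Q ^ (Suc p choose 2) * \<tau> ^ Suc p)"
    using qtheta_power_int_mult[OF assms(1), of "int (Suc p)"] unfolding power_int_of_nat theta_term_nat .
  have "((\<lambda>k. \<tau> ^ Suc p / qtheta q \<tau> * theta_term q ?\<sigma> k) has_sum \<tau> ^ Suc p / qtheta q \<tau> * qtheta q ?\<sigma>) UNIV"
    using Q assms(1) by (intro has_sum_cmult_right jacobi_triple_product) auto
  also have "(\<lambda>k. \<tau> ^ Suc p / qtheta q \<tau> * theta_term q ?\<sigma> k)
      = (\<lambda>k. (of_real (q powi k) * \<tau>) ^ Suc p / qtheta q (of_real (q powi k) * \<tau>))"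
    unfolding terms of_real_power_int qtheta_power_int_mult[OF assms(1)] power_mult_distrib
    by (simp add: mult_ac)
  also have "\<tau> ^ Suc p / qtheta q \<tau> * qtheta q ?\<sigma> = inverse (?Q ^ (Suc p choose 2))"
    using \<theta> assms(1) unfolding shifted by (simp add: field_simps)
  finally show ?thesis .
qed

section \<open>Orthogonality\<close>

text \<open>Reversal of the factors: \<open>1 - q ^ (j - n) = - q ^ (j - n) (1 - q ^ (n - j))\<close>. The identity
  is kept free of divisions so that the induction needs no cancellation.\<close>

lemma qpoch_q_power_minus:
  assumes "j \<le> n"
  shows "qpoch (of_real q powi (- int n)) q j * qpoch (of_real q) q (n - j) * of_real q ^ (n * j)
           = (-1) ^ j * of_real q ^ (j choose 2) * qpoch (of_real q) q n"
  using assms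
proof (induction j)
  case (Suc j)
  let ?Q = "complex_of_real q"
  have Q: "?Q \<noteq> 0" using q by simp
  obtain d where n: "n = Suc (j + d)"
    using Suc.prems by (metis Suc_le_D add_Suc le_Suc_ex)
  have last: "(1 - ?Q powi (- int n) * ?Q ^ j) * ?Q ^ n = - (?Q ^ j) * (1 - ?Q * ?Q ^ d)"
  proof -
    have "?Q powi (- int n) * ?Q ^ n = 1"
      using Q by (simp only: power_int_minus power_int_of_nat) simp
    then have "(1 - ?Q powi (- int n) * ?Q ^ j) * ?Q ^ n = ?Q ^ n - ?Q ^ j"
      by (simp add: left_diff_distrib)
    also have "\<dots> = - (?Q ^ j) * (1 - ?Q * ?Q ^ d)"
      by (simp add: n power_add algebra_simps)
    finally show ?thesis .
  qed
  have "qpoch (?Q powi (- int n)) q (Suc j) * qpoch ?Q q d * ?Q ^ (n * Suc j)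
      = qpoch (?Q powi (- int n)) q j * qpoch ?Q q d * ?Q ^ (n * j)
          * ((1 - ?Q powi (- int n) * ?Q ^ j) * ?Q ^ n)"
    by (simp add: qpoch_Suc power_add mult_ac)
  also have "\<dots> = (qpoch (?Q powi (- int n)) q j * (qpoch ?Q q d * (1 - ?Q * ?Q ^ d)) * ?Q ^ (n * j)) * (- (?Q ^ j))"
    unfolding last by (simp only: mult_ac)
  also have "qpoch ?Q q d * (1 - ?Q * ?Q ^ d) = qpoch ?Q q (n - j)"
    by (simp add: n qpoch_Suc Suc_diff_le)
  finally show ?case
    using Suc by (simp add: n numeral_2_eq_2 power_add mult_ac)
qed (simp add: binomial_eq_0)

lemma stieltjes_wigert_eq_poly:
  "stieltjes_wigert n x q = (\<Sum>i\<le>n. sw_coeff q n i * x ^ i)"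
proof -
  let ?Q = "complex_of_real q"
  have Q: "?Q \<noteq> 0" using q by simp
  have "1 / qpoch ?Q q n * (qpoch (?Q powi (- int n)) q i / qpoch ?Q q i
            * (-1) ^ i * ?Q ^ (i choose 2) * (- x * ?Q ^ (n + 1)) ^ i) = sw_coeff q n i * x ^ i"
    if "i \<le> n" for i
  proof -
    have sq: "i ^ 2 = (i choose 2) + (i choose 2) + i"
      by (induction i) (simp_all add: numeral_2_eq_2)
    have P: "qpoch (?Q powi (- int n)) q i * ?Q ^ (n * i)
        = (-1) ^ i * ?Q ^ (i choose 2) * qpoch ?Q q n / qpoch ?Q q (n - i)"
      using qpoch_q_power_minus[OF that] qpoch_q_nonzero[of "n - i"] by (simp add: field_simps)
    have X: "(- x * ?Q ^ (n + 1)) ^ i = (-1) ^ i * x ^ i * (?Q ^ (n * i) * ?Q ^ i)"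
      by (simp add: power_mult_distrib power_mult[symmetric] power_minus' mult_ac
           flip: power_mult power_add)
    have sign: "(-1) ^ i * (-1) ^ i = (1 :: complex)"
      by (simp flip: power_mult_distrib)
    have "1 / qpoch ?Q q n * (qpoch (?Q powi (- int n)) q i / qpoch ?Q q i
            * (-1) ^ i * ?Q ^ (i choose 2) * (- x * ?Q ^ (n + 1)) ^ i)
        = ((-1) ^ i * (-1) ^ i) * (qpoch (?Q powi (- int n)) q i * ?Q ^ (n * i))
            * (?Q ^ (i choose 2) * ?Q ^ i * x ^ i) / (qpoch ?Q q n * qpoch ?Q q i)"
      unfolding X by (simp add: mult_ac)
    also have "\<dots> = sw_coeff q n i * x ^ i"
      unfolding sign P sw_coeff_def sq power_add using qpoch_q_nonzero[of n]
      by (simp add: mult_ac)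
    finally show ?thesis .
  qed
  then show ?thesis
    unfolding stieltjes_wigert_eq_sum[OF less_imp_neq[OF q(1), symmetric]] sum_distrib_left
    by (simp add: atLeast0AtMost)
qed

text \<open>This is the integral of \<open>S\<^sub>n(x) x ^ j\<close>. Because
  \<open>i\<^sup>2 - ((i + j + 1) choose 2) = (i choose 2) - i j - ((j + 1) choose 2)\<close>,
  the summand is that of the \<open>q\<close>-binomial theorem at \<open>z = - q ^ (- j)\<close>, up to a constant factor.\<close>

lemma sum_sw_coeff_moment:
  "(\<Sum>i\<le>n. sw_coeff q n i * inverse (of_real q ^ (Suc (i + j) choose 2)))
     = qpoch (of_real q powi (- int j)) q n / (qpoch (of_real q) q n * of_real q ^ (Suc j choose 2))"
proof -
  let ?Q = "complex_of_real q"
  have Q: "?Q \<noteq> 0" using q by simp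
  have term_eq: "sw_coeff q n i * inverse (?Q ^ (Suc (i + j) choose 2))
      = (qbinom q n i * ?Q ^ (i choose 2) * (- (?Q powi (- int j))) ^ i) / (qpoch ?Q q n * ?Q ^ (Suc j choose 2))"
    for i
  proof -
    have "(i choose 2) + (Suc (i + j) choose 2) = i ^ 2 + (i * j + (Suc j choose 2))"
      by (induction i) (simp_all add: numeral_2_eq_2)
    then have "?Q ^ (i choose 2) * ?Q ^ (Suc (i + j) choose 2) = ?Q ^ (i ^ 2) * (?Q ^ (i * j) * ?Q ^ (Suc j choose 2))"
      by (simp only: flip: power_add)
    then have Q_eq: "?Q ^ (i ^ 2) * inverse (?Q ^ (Suc (i + j) choose 2))
        = ?Q ^ (i choose 2) * inverse (?Q ^ (i * j)) * inverse (?Q ^ (Suc j choose 2))"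
      using Q by (simp add: field_simps)
    have base: "(- (?Q powi (- int j))) ^ i = (-1) ^ i * inverse (?Q ^ (i * j))"
    proof -
      have "(- (?Q powi (- int j))) ^ i = (- 1 * inverse (?Q ^ j)) ^ i"
        by (simp only: power_int_minus power_int_of_nat) simp
      then show ?thesis
        by (simp only: power_mult_distrib power_inverse mult.commute[of i] power_mult)
    qed
    have "sw_coeff q n i * inverse (?Q ^ (Suc (i + j) choose 2))
        = (-1) ^ i * (?Q ^ (i ^ 2) * inverse (?Q ^ (Suc (i + j) choose 2)))
            / (qpoch ?Q q i * qpoch ?Q q (n - i))"
      by (simp add: sw_coeff_def)
    also have "\<dots> = (qbinom q n i * ?Q ^ (i choose 2) * (- (?Q powi (- int j))) ^ i)
            / (qpoch ?Q q n * ?Q ^ (Suc j choose 2))"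
      unfolding Q_eq base qbinom_def using qpoch_q_nonzero[of n]
      by (simp add: divide_inverse mult_ac)
    finally show ?thesis .
  qed
  show ?thesis
    using q_binomial[of "- (?Q powi (- int j))" n]
    by (simp add: term_eq sum_divide_distrib)
qed

lemma sum_sw_coeff_moment_eq_0:
  "j < n \<Longrightarrow> (\<Sum>i\<le>n. sw_coeff q n i * inverse (of_real q ^ (Suc (i + j) choose 2))) = 0"
  using q by (simp add: sum_sw_coeff_moment qpoch_neg_power_eq_0)

lemma sum_sw_coeff_moment_diag:
  "sw_coeff q n n * (\<Sum>i\<le>n. sw_coeff q n i * inverse (of_real q ^ (Suc (i + n) choose 2)))
     = 1 / (of_real q ^ n * qpoch (of_real q) q n)"
proof -
  let ?Q = "complex_of_real q"
  have Q: "?Q \<noteq> 0" using q by simp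
  have P: "?Q ^ (n * n) * qpoch (?Q powi (- int n)) q n = (-1) ^ n * ?Q ^ (n choose 2) * qpoch ?Q q n"
    using qpoch_q_power_minus[of n n] by (simp add: mult_ac)
  have C: "Suc n choose 2 = n + (n choose 2)"
    by (simp add: numeral_2_eq_2)
  have sign: "(-1) ^ n * (-1) ^ n = (1 :: complex)"
    by (simp flip: power_mult_distrib)
  have "sw_coeff q n n * (\<Sum>i\<le>n. sw_coeff q n i * inverse (?Q ^ (Suc (i + n) choose 2)))
      = (-1) ^ n * (?Q ^ (n * n) * qpoch (?Q powi (- int n)) q n)
          / (qpoch ?Q q n * qpoch ?Q q n * ?Q ^ (Suc n choose 2))"
    unfolding sum_sw_coeff_moment by (simp add: sw_coeff_def power2_eq_square mult_ac)
  also have "\<dots> = ((-1) ^ n * (-1) ^ n) * (?Q ^ (n choose 2) * qpoch ?Q q n)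
          / (qpoch ?Q q n * qpoch ?Q q n * ?Q ^ (Suc n choose 2))"
    unfolding P by (simp only: mult_ac)
  also have "\<dots> = 1 / (?Q ^ n * qpoch ?Q q n)"
    unfolding sign C power_add using Q qpoch_q_nonzero[of n] by simp
  finally show ?thesis .
qed

text \<open>By symmetry the second polynomial may be taken to have the larger degree \<open>n\<close>; it is
  orthogonal to every monomial of smaller degree, so only the monomial of degree \<open>n\<close> in the first
  one can contribute.\<close>

lemma stieltjes_wigert_orthogonality:
  assumes "\<tau> \<noteq> 0" and "\<tau> \<notin> {- of_real (q powi k) | k::int. True}"
  shows "((\<lambda>k. stieltjes_wigert n (of_real (q powi k) * \<tau>) q * stieltjes_wigert m (of_real (q powi k) * \<tau>) q
             * (of_real (q powi k) * \<tau>) / qtheta q (of_real (q powi k) * \<tau>))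
           has_sum (if n = m then 1 else 0) / (of_real q ^ n * qpoch (of_real q) q n)) UNIV"
proof (induction n m rule: linorder_wlog)
  case (sym n m)
  then show ?case by (cases "n = m") (auto simp: mult_ac)
next
  case (le m n)
  let ?x = "\<lambda>k. complex_of_real (q powi k) * \<tau>"
  let ?\<mu> = "\<lambda>p. inverse (complex_of_real q ^ (Suc p choose 2))"
  have "((\<lambda>k. \<Sum>j\<le>m. \<Sum>i\<le>n. sw_coeff q m j * sw_coeff q n i * (?x k ^ Suc (i + j) / qtheta q (?x k)))
      has_sum (\<Sum>j\<le>m. \<Sum>i\<le>n. sw_coeff q m j * sw_coeff q n i * ?\<mu> (i + j))) UNIV"
    by (intro has_sum_sum has_sum_cmult_right stieltjes_wigert_moment assms)
  also have "(\<lambda>k. \<Sum>j\<le>m. \<Sum>i\<le>n. sw_coeff q m j * sw_coeff q n i * (?x k ^ Suc (i + j) / qtheta q (?x k)))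
      = (\<lambda>k. stieltjes_wigert m (?x k) q * stieltjes_wigert n (?x k) q * ?x k / qtheta q (?x k))"
    unfolding stieltjes_wigert_eq_poly sum_product
    unfolding sum_distrib_right sum_divide_distrib by (simp add: power_add mult_ac)
  also have "(\<Sum>j\<le>m. \<Sum>i\<le>n. sw_coeff q m j * sw_coeff q n i * ?\<mu> (i + j))
      = (\<Sum>j\<le>m. sw_coeff q m j * (\<Sum>i\<le>n. sw_coeff q n i * ?\<mu> (i + j)))"
    by (simp only: sum_distrib_left mult.assoc)
  also have "\<dots> = (\<Sum>j\<in>{..m} \<inter> {n}. sw_coeff q m j * (\<Sum>i\<le>n. sw_coeff q n i * ?\<mu> (i + j)))"
  proof (intro sum.mono_neutral_right ballI)
    fix j assume "j \<in> {..m} - {..m} \<inter> {n}"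
    with le have "j < n" by auto
    then show "sw_coeff q m j * (\<Sum>i\<le>n. sw_coeff q n i * ?\<mu> (i + j)) = 0"
      by (simp only: sum_sw_coeff_moment_eq_0 mult_zero_right)
  qed auto
  also have "\<dots> = (if m = n then 1 else 0) / (of_real q ^ m * qpoch (of_real q) q m)"
    using le sum_sw_coeff_moment_diag[of n] by auto
  finally show ?case .
qed

end

text \<open>The \<open>q\<close>-integral is \<open>(1 - q) / \<lambda>\<close> times the bilateral sum, so one summability statement
  and one value serve for both.\<close>

theorem mainTheorem7:
  fixes q :: real and lam :: complex and n m :: nat
  assumes "0 < q" and "q < 1"
    and "lam \<noteq> 0"
    and "lam \<notin> {- of_real (q powi k) | k::int. True}"
  shows
    "(\<lambda>k::int. stieltjes_wigert n (of_real (q powi k) * lam) q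
              * stieltjes_wigert m (of_real (q powi k) * lam) q
              * (of_real (q powi k) * lam)
              / qtheta q (of_real (q powi k) * lam)) summable_on UNIV
     \<and> q_integrable q (\<lambda>x. stieltjes_wigert n (of_real x * lam) q
              * stieltjes_wigert m (of_real x * lam) q / qtheta q (of_real x * lam))
     \<and> (\<Sum>\<^sub>\<infinity>k::int. stieltjes_wigert n (of_real (q powi k) * lam) q
              * stieltjes_wigert m (of_real (q powi k) * lam) q
              * (of_real (q powi k) * lam)
              / qtheta q (of_real (q powi k) * lam))
        = lam / of_real (1 - q)
          * q_integral q (\<lambda>x. stieltjes_wigert n (of_real x * lam) q
              * stieltjes_wigert m (of_real x * lam) q / qtheta q (of_real x * lam))
     \<and> lam / of_real (1 - q)
          * q_integral q (\<lambda>x. stieltjes_wigert n (of_real x * lam) q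
              * stieltjes_wigert m (of_real x * lam) q / qtheta q (of_real x * lam))
        = (if n = m then 1 else 0) / (of_real q ^ n * qpoch (of_real q) q n)"
proof -
  let ?f = "\<lambda>x. stieltjes_wigert n (of_real x * lam) q * stieltjes_wigert m (of_real x * lam) q
              / qtheta q (of_real x * lam)"
  let ?s = "(if n = m then 1 else 0) / (of_real q ^ n * qpoch (of_real q) q n) :: complex"
  have sum: "((\<lambda>k::int. stieltjes_wigert n (of_real (q powi k) * lam) q
              * stieltjes_wigert m (of_real (q powi k) * lam) q
              * (of_real (q powi k) * lam)
              / qtheta q (of_real (q powi k) * lam)) has_sum ?s) UNIV"
    using assms by (intro stieltjes_wigert_orthogonality) auto
  from has_sum_cmult_right[OF this, of "inverse lam"]
  have "((\<lambda>k::int. of_real (q powi k) * ?f (q powi k)) has_sum ?s / lam) UNIV"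
    using assms(3) by (simp add: field_simps)
  then have "q_integrable q ?f" "q_integral q ?f = of_real (1 - q) * (?s / lam)"
    unfolding q_integrable_def q_integral_def by (auto simp: summable_on_def infsumI)
  moreover from this have "lam / of_real (1 - q) * q_integral q ?f = ?s"
    using assms(2,3) by simp
  ultimately show ?thesis
    using sum by (simp only: has_sum_iff)
qed

end
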